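(* For $b\ge4$, the number of terms in the expansion $$h_b=\sum_{i=3}^{b-1}\bigl([h_3,P_{i-2}]+[h_2,P_{i-1}]+[Q_i],\ \mathcal P_{b-1-i}\bigr)$$ of the Kauffman bracket polynomial $h_b$ of $T(5,b)$ is $2^{b-4}$.
   Context: $T(5,b)$ is the 5-strand billiard table (Chebyshev) diagram with $2(b-1)$ crossings of indeterminate sign, and $h_b$ is its Kauffman bracket polynomial. In the displayed expansion, parentheses and brackets denote concatenated products of blocks; $h_2,h_3$, $P_k$ ($k\ge1$) and $Q_i$ ($i\ge3$) are certain fixed explicit blocks (Laurent polynomial expressions in $A$ depending on the crossing signs), treated for this count as unexpanded formal symbols. $\mathcal P_m$ is the sum over all ordered partitions (compositions) $m=i_1+\dots+i_r$ of $m$ into positive integer parts of the concatenated product $[P_{i_1},\dots,P_{i_r}]$, with $\mathcal P_0$ the empty product. In the count, the bracketed sum $[h_3,P_{i-2}]+[h_2,P_{i-1}]+[Q_i]$ for each $i$ is regarded as a single unit, so a term of the expansion is a pair consisting of an index $i\in\{3,\dots,b-1\}$ and one of the summands $[P_{i_1},\dots,P_{i_r}]$ of $\mathcal P_{b-1-i}$. *)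

theory Defs
  imports Main "HOL-Library.Multiset"
begin

text \<open>
  The blocks in the expansion of the Kauffman bracket polynomial of \<open>T(5,b)\<close> are formal symbols;
  the Laurent polynomials they abbreviate are never substituted.
  A concatenated product of blocks is a word, and a formal sum is a multiset of summands, so that
  no two summands are ever merged and the number of summands is the size of the multiset.
\<close>

datatype block = h2 | h3 | P_block nat | Q_block nat

type_synonym block_word = "block list"

definition compositions :: "nat \<Rightarrow> nat list set" where
  "compositions m = {is. (\<forall>k\<in>set is. 1 \<le> k) \<and> sum_list is = m}"

lemma finite_compositions: "finite (compositions m)"
proof (rule finite_subset)
  have "length is \<le> sum_list is" if "\<forall>k\<in>set is. 1 \<le> k" for "is" :: "nat list"
    using that by (induction "is") auto
  then show "compositions m \<subseteq> {is. set is \<subseteq> {0..m} \<and> length is \<le> m}"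
    by (auto simp: compositions_def dest: member_le_sum_list)
  show "finite {is. set is \<subseteq> {0..m} \<and> length is \<le> m}"
    by (rule finite_lists_length_le) simp
qed

definition calP :: "nat \<Rightarrow> block_word multiset" where
  "calP m = (\<Sum>is\<in>compositions m. {#map P_block is#})"

definition bracket_unit :: "nat \<Rightarrow> block_word multiset" where
  "bracket_unit i = {#[h3, P_block (i - 2)]#} + {#[h2, P_block (i - 1)]#} + {#[Q_block i]#}"

text \<open>
  The product of the \<open>i\<close>-th bracketed sum with \<open>calP (b - 1 - i)\<close> is distributed over the summands
  of the second factor only: the bracketed sum stays a single factor, the first component of
  each pair.
\<close>

definition h_expansion :: "nat \<Rightarrow> (block_word multiset \<times> block_word) multiset" where
  "h_expansion b = (\<Sum>i\<in>{3..b - 1}. {#(bracket_unit i, w). w \<in># calP (b - 1 - i)#})"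

text \<open>
  Terms correspond to pairs of an index \<open>i\<close> and a composition of \<open>b - 1 - i\<close>.
\<close>

lemma h_expansion_eq_sum_pairs:
  "h_expansion b =
    (\<Sum>(i, is)\<in>(SIGMA i:{3..b - 1}. compositions (b - 1 - i)).
      {#(bracket_unit i, map P_block is)#})"
proof -
  have "image_mset f (\<Sum>x\<in>A. {#g x#}) = (\<Sum>x\<in>A. {#f (g x)#})" if "finite A"
    for f :: "block_word \<Rightarrow> block_word multiset \<times> block_word" and g and A :: "nat list set"
    using that by (induction A) auto
  then show ?thesis
    by (simp add: h_expansion_def calP_def finite_compositions sum.Sigma)
qed

end

theory Submission
  imports Defs
begin

text \<open>
  A term is determined by a composition of \<open>m = b - 1 - i\<close>, and as \<open>i\<close> runs over \<open>3, \<dots>, b - 1\<close>,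
  \<open>m\<close> runs over \<open>0, \<dots>, b - 4\<close>. So the terms are counted by the number of compositions of all
  integers up to \<open>n = b - 4\<close>. Removing the first part identifies these with the compositions of
  \<open>Suc n\<close> (lemma \<open>card_compositions_Suc\<close>), since the first part is
  \<open>Suc n\<close> minus the sum of what is left. Hence the count for \<open>n\<close> doubles at each step: the new summand equals everything that was
  there before. It starts at 1, the empty composition of 0, so that it is \<open>2 ^ n\<close>.
\<close>

lemma compositions_0: "compositions 0 = {[]}"
proof -
  have "is = []" if "\<forall>k\<in>set is. 1 \<le> k" "sum_list is = 0" for "is" :: "nat list"
    using that by (cases "is") auto
  then show ?thesis
    by (auto simp: compositions_def)
qed

lemma compositions_Suc:
  "compositions (Suc n) = (\<Union>m\<le>n. Cons (Suc n - m) ` compositions m)"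
proof (rule set_eqI, rule iffI)
  fix js
  assume js: "js \<in> compositions (Suc n)"
  then obtain k ks where "js = k # ks"
    by (cases js) (auto simp: compositions_def)
  with js have "sum_list ks \<le> n" "js = (Suc n - sum_list ks) # ks" "ks \<in> compositions (sum_list ks)"
    by (auto simp: compositions_def)
  then show "js \<in> (\<Union>m\<le>n. Cons (Suc n - m) ` compositions m)"
    by blast
qed (auto simp: compositions_def)

lemma card_compositions_Suc: "card (compositions (Suc n)) = (\<Sum>m\<le>n. card (compositions m))"
proof -
  have "card (compositions (Suc n)) = (\<Sum>m\<le>n. card (Cons (Suc n - m) ` compositions m))"
    unfolding compositions_Suc
    by (rule card_UN_disjoint) (simp_all add: finite_compositions, auto simp: compositions_def)
  then show ?thesis
    by (simp add: card_image)
qed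

lemma sum_card_compositions: "(\<Sum>m\<le>n. card (compositions m)) = 2 ^ n"
  by (induction n) (simp_all add: compositions_0 card_compositions_Suc)

lemma size_sum_mset_family:
  fixes f :: "'a \<Rightarrow> 'b multiset"
  shows "size (\<Sum>x\<in>A. f x) = (\<Sum>x\<in>A. size (f x))"
  by (induction A rule: infinite_finite_induct) auto

theorem proposition6p3:
  fixes b :: nat
  assumes "b \<ge> 4"
  shows "size (h_expansion b) = 2 ^ (b - 4)"
proof -
  have "size (h_expansion b) = (\<Sum>i\<in>{3..b - 1}. card (compositions (b - 1 - i)))"
    by (simp add: h_expansion_def calP_def size_sum_mset_family)
  also have "\<dots> = (\<Sum>m\<le>b - 4. card (compositions m))"
    by (rule sum.reindex_bij_witness[where i = "\<lambda>m. b - 1 - m" and j = "\<lambda>i. b - 1 - i"])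
      (use assms in auto)
  also have "\<dots> = 2 ^ (b - 4)"
    by (rule sum_card_compositions)
  finally show ?thesis .
qed

end
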